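(* Let $f^1,\dots,f^p:\mathbb{R}^n\to\mathbb{R}^m$ be twice continuously differentiable and $F(x)=\{f^1(x),\dots,f^p(x)\}$. Let $\beta\in(0,1)$, let $\bar x\in\mathbb{R}^n$ not be a stationary point of the problem of minimizing $F$ with respect to the lower set less relation, and let $(\bar a,\bar u)\in P_{\bar x}\times\mathbb{R}^n$ be such that $\Phi(\bar x)=\xi_{\bar x}(\bar a,\bar u)$. Put $\bar w=w(\bar x)$. Then there exists $\tilde t>0$ such that for all $t\in(0,\tilde t]$ and all $j\in\{1,\dots,\bar w\}$, $$f^{\bar a_j}(\bar x+t\bar u)\preceq f^{\bar a_j}(\bar x)+\beta t\,\nabla f^{\bar a_j}(\bar x)^\top\bar u .$$ Additionally, for all $t\in(0,\tilde t]$, $$F(\bar x+t\bar u)\preceq^l\left\{f^{\bar a_j}(\bar x)+\beta t\,\nabla f^{\bar a_j}(\bar x)^\top\bar u\right\}_{j\in\{1,\dots,\bar w\}}\prec^l F(\bar x).$$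
   Context: $K\subset\mathbb{R}^m$ is a closed, convex, pointed cone with nonempty interior, and $e\in\mathrm{int}(K)$ is fixed. For $y,z\in\mathbb{R}^m$, $y\preceq z$ iff $z-y\in K$. For nonempty $A,B\subseteq\mathbb{R}^m$: $A\preceq^l B$ iff $B\subseteq A+K$, and $A\prec^l B$ iff $B\subseteq A+\mathrm{int}(K)$. The Gerstewitz function is $\mathcal{G}_e(y)=\min\{t\in\mathbb{R}: te\in y+K\}$. For $A\subseteq\mathbb{R}^m$, $\mathrm{Min}(A,K)=\{z\in A:(z-K)\cap A=\{z\}\}$. Put $I(x)=\{i: f^i(x)\in\mathrm{Min}(F(x),K)\}$, $I_r(x)=\{i\in I(x): f^i(x)=r\}$, $w(x)=|\mathrm{Min}(F(x),K)|$. Enumerating $\mathrm{Min}(F(x),K)=\{r_1^x,\dots,r_{w(x)}^x\}$, the partition set at $x$ is $P_x=\prod_{j=1}^{w(x)} I_{r_j^x}(x)$, with elements $a=(a_1,\dots,a_{w(x)})$. $\nabla f^i(x)\in\mathbb{R}^{n\times m}$ denotes the transposed Jacobian, so $\nabla f^i(x)^\top u\in\mathbb{R}^m$. A point $\bar x$ is stationary if for every $a\in P_{\bar x}$ and every $u\in\mathbb{R}^n$ there is $j\in\{1,\dots,w(\bar x)\}$ with $\nabla f^{a_j}(\bar x)^\top u\notin-\mathrm{int}(K)$. For each $i$ and $x$, $B^i(x)=(B^{i,1}(x),\dots,B^{i,m}(x))$ is an $m$-tuple of symmetric real $n\times n$ matrices (Hessian approximation), $u^\top B^i(x)u:=(u^\top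 B^{i,l}(x)u)_{l=1}^m\in\mathbb{R}^m$, and $B^i(x)$ is positive definite in the sense that $u^\top B^i(x)u\in\mathrm{int}(K)$ for all $u\neq0$. $\xi_x(a,u)=\max_{1\le j\le w(x)}\mathcal{G}_e\big(\nabla f^{a_j}(x)^\top u+\tfrac12u^\top B^{a_j}(x)u\big)$ for $a\in P_x,\ u\in\mathbb{R}^n$, and $\Phi(x)=\min_{(a,u)\in P_x\times\mathbb{R}^n}\xi_x(a,u)$. *)

theory Defs
  imports "HOL-Analysis.Analysis" "HOL-Library.Set_Algebras"
begin

definition pointed_cone :: "(real ^ 'm) set \<Rightarrow> bool" where
  "pointed_cone K \<longleftrightarrow> cone K \<and> K \<inter> uminus ` K = {0}"

definition cone_le :: "(real ^ 'm) set \<Rightarrow> real ^ 'm \<Rightarrow> real ^ 'm \<Rightarrow> bool" where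
  "cone_le K y z \<longleftrightarrow> z - y \<in> K"

definition lower_set_le :: "(real ^ 'm) set \<Rightarrow> (real ^ 'm) set \<Rightarrow> (real ^ 'm) set \<Rightarrow> bool" where
  "lower_set_le K A B \<longleftrightarrow> B \<subseteq> A + K"

definition lower_set_less :: "(real ^ 'm) set \<Rightarrow> (real ^ 'm) set \<Rightarrow> (real ^ 'm) set \<Rightarrow> bool" where
  "lower_set_less K A B \<longleftrightarrow> B \<subseteq> A + interior K"

definition min_elements :: "(real ^ 'm) set \<Rightarrow> (real ^ 'm) set \<Rightarrow> (real ^ 'm) set" where
  "min_elements A K = {z \<in> A. (\<lambda>k. z - k) ` K \<inter> A = {z}}"

text \<open>On the reals, \<open>LEAST t. P t\<close> is the minimum of \<open>{t. P t}\<close>; it is meaningful only when that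
  minimum is attained. Here it is for closed pointed convex cones \<open>K\<close> and \<open>e\<close> in the interior
  of \<open>K\<close>.\<close>

definition gerstewitz :: "(real ^ 'm) set \<Rightarrow> real ^ 'm \<Rightarrow> real ^ 'm \<Rightarrow> real" where
  "gerstewitz K e y = (LEAST t. t *\<^sub>R e \<in> (\<lambda>k. y + k) ` K)"

definition twice_continuously_differentiable :: "(real ^ 'n \<Rightarrow> real ^ 'm) \<Rightarrow> bool" where
  "twice_continuously_differentiable g \<longleftrightarrow>
     (\<exists>(g' :: real ^ 'n \<Rightarrow> (real ^ 'n) \<Rightarrow>\<^sub>L (real ^ 'm))
       (g'' :: real ^ 'n \<Rightarrow> (real ^ 'n) \<Rightarrow>\<^sub>L ((real ^ 'n) \<Rightarrow>\<^sub>L (real ^ 'm))).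
        (\<forall>x. (g has_derivative blinfun_apply (g' x)) (at x)) \<and>
        (\<forall>x. (g' has_derivative blinfun_apply (g'' x)) (at x)) \<and>
        continuous_on UNIV g'')"

text \<open>The gradient is the transposed Jacobian, an \<open>n \<times> m\<close> matrix.\<close>

definition grad :: "(real ^ 'n \<Rightarrow> real ^ 'm) \<Rightarrow> real ^ 'n \<Rightarrow> real ^ 'm ^ 'n" where
  "grad g x = transpose (jacobian g (at x))"

text \<open>An \<open>m\<close>-tuple of \<open>n \<times> n\<close> matrices is a function from the index type \<open>'m\<close> to matrices.\<close>

definition quad_form :: "('m::finite \<Rightarrow> real ^ 'n ^ 'n) \<Rightarrow> real ^ 'n \<Rightarrow> real ^ 'm" where
  "quad_form M u = (\<chi> l. u \<bullet> (M l *v u))"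

definition cone_pos_def :: "(real ^ 'm) set \<Rightarrow> ('m \<Rightarrow> real ^ 'n ^ 'n) \<Rightarrow> bool" where
  "cone_pos_def K M \<longleftrightarrow> (\<forall>u. u \<noteq> 0 \<longrightarrow> quad_form M u \<in> interior K)"

definition set_map :: "nat \<Rightarrow> (nat \<Rightarrow> real ^ 'n \<Rightarrow> real ^ 'm) \<Rightarrow> real ^ 'n \<Rightarrow> (real ^ 'm) set" where
  "set_map p f x = (\<lambda>i. f i x) ` {1..p}"

definition active_indices ::
  "(real ^ 'm) set \<Rightarrow> nat \<Rightarrow> (nat \<Rightarrow> real ^ 'n \<Rightarrow> real ^ 'm) \<Rightarrow> real ^ 'n \<Rightarrow> nat set" where
  "active_indices K p f x = {i \<in> {1..p}. f i x \<in> min_elements (set_map p f x) K}"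

definition active_indices_at ::
  "(real ^ 'm) set \<Rightarrow> nat \<Rightarrow> (nat \<Rightarrow> real ^ 'n \<Rightarrow> real ^ 'm) \<Rightarrow> real ^ 'm \<Rightarrow> real ^ 'n \<Rightarrow> nat set" where
  "active_indices_at K p f v x = {i \<in> active_indices K p f x. f i x = v}"

definition num_min ::
  "(real ^ 'm) set \<Rightarrow> nat \<Rightarrow> (nat \<Rightarrow> real ^ 'n \<Rightarrow> real ^ 'm) \<Rightarrow> real ^ 'n \<Rightarrow> nat" where
  "num_min K p f x = card (min_elements (set_map p f x) K)"

text \<open>\<open>r x 1, \<dots>, r x (num_min K p f x)\<close> is the chosen enumeration of the minimal elements at \<open>x\<close>.\<close>

definition min_enumeration ::
  "(real ^ 'm) set \<Rightarrow> nat \<Rightarrow> (nat \<Rightarrow> real ^ 'n \<Rightarrow> real ^ 'm) \<Rightarrow>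
    (real ^ 'n \<Rightarrow> nat \<Rightarrow> real ^ 'm) \<Rightarrow> bool" where
  "min_enumeration K p f r \<longleftrightarrow>
     (\<forall>x. bij_betw (r x) {1..num_min K p f x} (min_elements (set_map p f x) K))"

definition partition_set ::
  "(real ^ 'm) set \<Rightarrow> nat \<Rightarrow> (nat \<Rightarrow> real ^ 'n \<Rightarrow> real ^ 'm) \<Rightarrow>
    (real ^ 'n \<Rightarrow> nat \<Rightarrow> real ^ 'm) \<Rightarrow> real ^ 'n \<Rightarrow> (nat \<Rightarrow> nat) set" where
  "partition_set K p f r x = (\<Pi>\<^sub>E j\<in>{1..num_min K p f x}. active_indices_at K p f (r x j) x)"

definition stationary ::
  "(real ^ 'm) set \<Rightarrow> nat \<Rightarrow> (nat \<Rightarrow> real ^ 'n \<Rightarrow> real ^ 'm) \<Rightarrow>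
    (real ^ 'n \<Rightarrow> nat \<Rightarrow> real ^ 'm) \<Rightarrow> real ^ 'n \<Rightarrow> bool" where
  "stationary K p f r x \<longleftrightarrow>
     (\<forall>a \<in> partition_set K p f r x. \<forall>u. \<exists>j \<in> {1..num_min K p f x}.
        transpose (grad (f (a j)) x) *v u \<notin> uminus ` interior K)"

definition xi ::
  "(real ^ 'm) set \<Rightarrow> real ^ 'm \<Rightarrow> nat \<Rightarrow> (nat \<Rightarrow> real ^ 'n \<Rightarrow> real ^ 'm) \<Rightarrow>
    (nat \<Rightarrow> real ^ 'n \<Rightarrow> 'm \<Rightarrow> real ^ 'n ^ 'n) \<Rightarrow>
    real ^ 'n \<Rightarrow> (nat \<Rightarrow> nat) \<Rightarrow> real ^ 'n \<Rightarrow> real" where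
  "xi K e p f B x a u =
     Max ((\<lambda>j. gerstewitz K e (transpose (grad (f (a j)) x) *v u
                 + (1/2) *\<^sub>R quad_form (B (a j) x) u)) ` {1..num_min K p f x})"

text \<open>The minimum is attained when the approximations \<open>B i x\<close> are positive definite.\<close>

definition Phi ::
  "(real ^ 'm) set \<Rightarrow> real ^ 'm \<Rightarrow> nat \<Rightarrow> (nat \<Rightarrow> real ^ 'n \<Rightarrow> real ^ 'm) \<Rightarrow>
    (nat \<Rightarrow> real ^ 'n \<Rightarrow> 'm \<Rightarrow> real ^ 'n ^ 'n) \<Rightarrow>
    (real ^ 'n \<Rightarrow> nat \<Rightarrow> real ^ 'm) \<Rightarrow> real ^ 'n \<Rightarrow> real" where
  "Phi K e p f B r x =
     (LEAST v. v \<in> (\<lambda>(a, u). xi K e p f B x a u) ` (partition_set K p f r x \<times> UNIV))"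

end

theory Submission
  imports Defs
begin

text \<open>
  The heart of the matter is that the optimal \<open>u\<close> of the quadratic model is a
  descent direction, that is \<open>- \<nabla>f(x)\<^sup>T u \<in> interior K\<close> for
  each selected component of \<open>f\<close>; all three claims follow from this.

  To see it, note that \<open>gerstewitz K e y < 0\<close> exactly when \<open>- y \<in> interior K\<close>
  (\<open>gerstewitz_less_0_iff\<close>). At a nonstationary point some selection has a direction in which
  all its first-order terms lie in \<open>- interior K\<close>; along a short step in that direction the
  quadratic terms are negligible, so the model takes a negative value
  (\<open>nonstationary_xi_neg\<close>). The value of \<open>Phi\<close> is therefore negative, and at the
  optimal pair every model term is in \<open>- interior K\<close>. Subtracting from it the quadratic term,
  which lies in \<open>K\<close>, leaves the first-order term in \<open>- interior K\<close>.

  The middle step uses that \<open>Phi\<close> is a lower bound of the model values (\<open>Phi_le_xi\<close>).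
  Since \<open>Phi\<close> is defined by \<open>LEAST\<close>, this has content only if the minimum is
  attained. There are finitely many selections, and for a fixed one the model is continuous, because
  the Gerstewitz function is Lipschitz, and positive outside a ball, because its quadratic
  part dominates there (\<open>model_coercive\<close>); hence it attains its minimum
  (\<open>xi_attains_min\<close>).

  Given the descent direction, the decrease condition is the definition of the derivative together
  with openness of \<open>interior K\<close> (\<open>armijo_descent\<close>), and one step bound serves the
  finitely many components. The first set relation restates this decrease. For the second, every
  element of the finite set \<open>F(x)\<close> lies above a minimal one
  (\<open>min_element_below\<close>), each minimal element is the value of a selected component, and
  moving along the first-order term lowers that value by an element of \<open>interior K\<close>.
\<close>

section \<open>Solid pointed cones\<close>

locale solid_pointed_cone =
  fixes K :: "(real ^ 'm) set" and e :: "real ^ 'm"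
  assumes closed_K: "closed K"
    and convex_K: "convex K"
    and pointed_K: "pointed_cone K"
    and e_interior: "e \<in> interior K"
begin

lemma scale_mem: "y \<in> K \<Longrightarrow> 0 \<le> c \<Longrightarrow> c *\<^sub>R y \<in> K"
  using pointed_K by (auto simp: pointed_cone_def cone_def)

lemma add_mem: "y \<in> K \<Longrightarrow> z \<in> K \<Longrightarrow> y + z \<in> K"
  using convex_K pointed_K convex_cone[of K] by (auto simp: pointed_cone_def)

lemma zero_mem: "0 \<in> K"
  using pointed_K by (auto simp: pointed_cone_def)

lemma antisym_mem:
  assumes "y \<in> K" "- y \<in> K" shows "y = 0"
proof -
  have "y \<in> uminus ` K"
    using assms(2) by (rule rev_image_eqI) simp
  then show ?thesis
    using assms(1) pointed_K by (auto simp: pointed_cone_def)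
qed

lemma interior_mem: "y \<in> interior K \<Longrightarrow> y \<in> K"
  using interior_subset by blast

lemma interior_add_mem:
  assumes "y \<in> interior K" "z \<in> K" shows "y + z \<in> interior K"
proof -
  have "(+) z ` interior K \<subseteq> interior K"
    using assms(2) add_mem interior_mem
    by (intro interior_maximal open_translation open_interior) auto
  then show ?thesis
    using assms(1) by (auto simp: add.commute)
qed

lemma interior_scale_mem:
  assumes "y \<in> interior K" "0 < c" shows "c *\<^sub>R y \<in> interior K"
proof -
  have "(*\<^sub>R) c ` interior K \<subseteq> interior K"
    using assms(2) scale_mem interior_mem
    by (intro interior_maximal open_scaling open_interior) auto
  then show ?thesis
    using assms(1) by auto
qed

text \<open>
  A ball around 0 would contain some nonzero \<open>v\<close> together with \<open>- v\<close>,
  contradicting pointedness.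
\<close>

lemma zero_notin_interior: "0 \<notin> interior K"
proof
  assume "0 \<in> interior K"
  then obtain d where d: "d > 0" "ball 0 d \<subseteq> K"
    by (auto simp: mem_interior)
  obtain v :: "real ^ 'm" where v: "norm v = d / 2"
    using d(1) vector_choose_size[of "d / 2"] by auto
  have "v \<in> K" "- v \<in> K"
    using d v by (auto intro!: subsetD[OF d(2)])
  then have "v = 0"
    by (rule antisym_mem)
  then show False
    using v d(1) by simp
qed

lemma scale_e_mem_iff: "t *\<^sub>R e \<in> K \<longleftrightarrow> 0 \<le> t"
proof
  assume t: "t *\<^sub>R e \<in> K"
  show "0 \<le> t"
  proof (rule ccontr)
    assume "\<not> 0 \<le> t"
    then have "- e \<in> K"
      using scale_mem[OF t, of "- inverse t"] by simp
    then have "e = 0"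
      using antisym_mem e_interior interior_mem by blast
    then show False
      using zero_notin_interior e_interior by simp
  qed
qed (use e_interior interior_mem scale_mem in blast)

text \<open>
  The vector \<open>e\<close> is an order unit with a constant proportional to the norm: a ball of
  radius \<open>d\<close> around \<open>e\<close> inside \<open>K\<close>, rescaled, gives the constant
  \<open>1 / d\<close>. This makes the Gerstewitz function finite and Lipschitz.
\<close>

lemma order_unit:
  obtains c where "c > 0" "\<And>y. (c * norm y) *\<^sub>R e - y \<in> K"
proof -
  obtain d where d: "d > 0" "cball e d \<subseteq> K"
    using e_interior by (auto simp: mem_interior_cball)
  have "(inverse d * norm y) *\<^sub>R e - y \<in> K" for y
  proof (cases "y = 0")
    case True
    then show ?thesis using zero_mem by simp
  next
    case False
    have "e - (d / norm y) *\<^sub>R y \<in> K"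
      using d(1) False by (intro subsetD[OF d(2)]) (simp add: dist_norm)
    then have "(inverse d * norm y) *\<^sub>R (e - (d / norm y) *\<^sub>R y) \<in> K"
      using d(1) by (intro scale_mem) auto
    then show ?thesis
      using d(1) False by (simp add: algebra_simps)
  qed
  with d(1) show ?thesis
    by (intro that[of "inverse d"]) auto
qed

text \<open>
  On the finite set of elements of \<open>A\<close> below \<open>z\<close>, the strict cone order is
  transitive and asymmetric, so it has a minimal element there. This element is minimal in all of
  \<open>A\<close>, because whatever lies below it also lies below \<open>z\<close>.
\<close>

lemma min_element_below:
  assumes "finite A" "z \<in> A"
  obtains m where "m \<in> min_elements A K" "z - m \<in> K"
proof -
  define D where "D = {a \<in> A. z - a \<in> K}"
  define R where "R = (\<lambda>a b. b - a \<in> K \<and> a \<noteq> b)"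
  \<comment> \<open>Asymmetry and transitivity of the strict order both rest on pointedness.\<close>
  have "asymp_on D R"
  proof (rule asymp_onI)
    fix a b assume "R a b"
    then show "\<not> R b a"
      using antisym_mem[of "b - a"] by (auto simp: R_def)
  qed
  moreover have "transp_on D R"
  proof (rule transp_onI)
    fix a b c assume ab: "R a b" and bc: "R b c"
    have "c - a \<in> K"
      using ab bc add_mem[of "c - b" "b - a"] by (simp add: R_def)
    moreover have "a \<noteq> c"
      using ab bc antisym_mem[of "b - a"] by (auto simp: R_def)
    ultimately show "R a c"
      by (simp add: R_def)
  qed
  moreover have "finite D" "D \<noteq> {}"
    using assms zero_mem by (auto simp: D_def)
  ultimately obtain m where m: "m \<in> D" "\<And>a. a \<in> D \<Longrightarrow> a \<noteq> m \<Longrightarrow> \<not> R a m"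
    using Finite_Set.bex_min_element[of D R] by blast
  have "m - k = m" if "k \<in> K" "m - k \<in> A" for k
  proof (rule ccontr)
    assume neq: "m - k \<noteq> m"
    have "m - k \<in> D"
      using that m(1) add_mem[of "z - m" k] by (simp add: D_def algebra_simps)
    then show False
      using m(2)[of "m - k"] neq that by (simp add: R_def)
  qed
  moreover have "m = m - 0" by simp
  ultimately have "(\<lambda>k. m - k) ` K \<inter> A = {m}"
    using m(1) zero_mem by (force simp: D_def)
  then show ?thesis
    using m(1) by (intro that) (auto simp: D_def min_elements_def)
qed

section \<open>The Gerstewitz function\<close>

text \<open>
  The set of admissible \<open>t\<close> is closed, nonempty and bounded below, so that its least element
  exists, and it is upward closed since \<open>e \<in> K\<close>. Everything about the Gerstewitz
  function is deduced from this equivalence.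
\<close>

lemma gerstewitz_le_iff: "gerstewitz K e y \<le> t \<longleftrightarrow> t *\<^sub>R e - y \<in> K"
proof -
  obtain c where c: "\<And>y. (c * norm y) *\<^sub>R e - y \<in> K"
    by (rule order_unit) blast
  define S where "S = {t. t *\<^sub>R e - y \<in> K}"
  have "closed S"
    using closed_vimage[OF closed_K, of "\<lambda>t. t *\<^sub>R e - y"]
    by (simp add: S_def vimage_def continuous_intros)
  moreover have "S \<noteq> {}"
    using c[of y] by (auto simp: S_def)
  moreover have lower: "- (c * norm y) \<le> s" if "s \<in> S" for s
  proof -
    have "(s + c * norm y) *\<^sub>R e \<in> K"
      using add_mem[OF c[of "- y"], of "s *\<^sub>R e - y"] that by (simp add: S_def algebra_simps)
    then show ?thesis
      by (simp add: scale_e_mem_iff)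
  qed
  then have bdd: "bdd_below S"
    by (auto simp: bdd_below_def)
  ultimately have Inf: "Inf S \<in> S"
    by (intro closed_contains_Inf) auto
  have "(t *\<^sub>R e \<in> (\<lambda>k. y + k) ` K) \<longleftrightarrow> t \<in> S" for t
    by (force simp: S_def image_iff algebra_simps)
  then have G: "gerstewitz K e y = Inf S"
    unfolding gerstewitz_def using Inf bdd by (auto intro!: Least_equality cInf_lower)
  show ?thesis
  proof
    assume "gerstewitz K e y \<le> t"
    then have "(t - Inf S) *\<^sub>R e \<in> K"
      using G by (simp add: scale_e_mem_iff)
    then show "t *\<^sub>R e - y \<in> K"
      using add_mem[of "(t - Inf S) *\<^sub>R e" "Inf S *\<^sub>R e - y"] Inf
      by (simp add: S_def algebra_simps)
  next
    assume "t *\<^sub>R e - y \<in> K"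
    then show "gerstewitz K e y \<le> t"
      using G bdd by (simp add: S_def cInf_lower)
  qed
qed

lemma gerstewitz_less_0_iff: "gerstewitz K e y < 0 \<longleftrightarrow> - y \<in> interior K"
proof
  define t where "t = gerstewitz K e y"
  assume "gerstewitz K e y < 0"
  then have "(- t) *\<^sub>R e \<in> interior K"
    using e_interior unfolding t_def by (intro interior_scale_mem) auto
  moreover have "t *\<^sub>R e - y \<in> K"
    using gerstewitz_le_iff[of y t] by (simp add: t_def)
  ultimately show "- y \<in> interior K"
    using interior_add_mem by fastforce
next
  obtain c where c: "c > 0" "\<And>y. (c * norm y) *\<^sub>R e - y \<in> K"
    by (rule order_unit) blast
  assume "- y \<in> interior K"
  then obtain d where d: "d > 0" "cball (- y) d \<subseteq> K"
    by (auto simp: mem_interior_cball)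
  define s where "s = d / (norm e + 1)"
  have s: "s > 0" "s * norm e \<le> d"
    using d(1) by (auto simp: s_def field_simps add_pos_nonneg)
  then have "(- s) *\<^sub>R e - y \<in> K"
    by (intro subsetD[OF d(2)]) (simp add: dist_norm)
  then show "gerstewitz K e y < 0"
    using gerstewitz_le_iff[of y "- s"] s(1) by linarith
qed

text \<open>
  The function is Lipschitz with the order unit constant \<open>c\<close>: if \<open>t\<close> is
  admissible for \<open>z\<close>, then \<open>t + c * dist y z\<close> is admissible for \<open>y\<close>.
\<close>

lemma continuous_on_gerstewitz: "continuous_on UNIV (gerstewitz K e)"
proof -
  obtain c where c: "c > 0" "\<And>y. (c * norm y) *\<^sub>R e - y \<in> K"
    by (rule order_unit) blast
  have le: "gerstewitz K e y \<le> gerstewitz K e z + c * dist y z" for y z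
  proof -
    have "gerstewitz K e z *\<^sub>R e - z \<in> K"
      using gerstewitz_le_iff[of z] by blast
    then show ?thesis
      using add_mem[OF c(2)[of "y - z"]] unfolding gerstewitz_le_iff dist_norm
      by (fastforce simp: algebra_simps)
  qed
  have "c-lipschitz_on UNIV (gerstewitz K e)"
  proof (rule lipschitz_onI)
    fix y z
    show "dist (gerstewitz K e y) (gerstewitz K e z) \<le> c * dist y z"
      using le[of y z] le[of z y] by (simp add: dist_real_def dist_commute)
  qed (use c in simp)
  then show ?thesis
    by (rule lipschitz_on_continuous_on)
qed

end

section \<open>The quadratic model\<close>

lemma quad_form_scaleR: "quad_form M (c *\<^sub>R u) = c\<^sup>2 *\<^sub>R quad_form M u"
  by (simp add: quad_form_def vec_eq_iff matrix_vector_mult_scaleR power2_eq_square)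

lemma quad_form_0: "quad_form M 0 = 0"
  using quad_form_scaleR[of M 0 0] by simp

lemma continuous_on_quad_form: "continuous_on S (quad_form M)"
  unfolding quad_form_def
  by (intro continuous_intros matrix_vector_mult_linear_continuous_on)

lemma continuous_on_Max:
  fixes g :: "'i \<Rightarrow> 'a::topological_space \<Rightarrow> real"
  assumes "finite I" "I \<noteq> {}" "\<And>i. i \<in> I \<Longrightarrow> continuous_on S (g i)"
  shows "continuous_on S (\<lambda>x. Max ((\<lambda>i. g i x) ` I))"
  using assms
proof (induction I rule: finite_ne_induct)
  case (insert i I)
  then have "continuous_on S (\<lambda>x. max (g i x) (Max ((\<lambda>i. g i x) ` I)))"
    by (intro continuous_on_max) auto
  then show ?case
    using insert.hyps by simp
qed simp

context solid_pointed_cone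
begin

lemma quad_form_mem:
  assumes "cone_pos_def K M" shows "quad_form M u \<in> K"
proof (cases "u = 0")
  case True
  then show ?thesis
    by (simp add: quad_form_0 zero_mem)
next
  case False
  then show ?thesis
    using assms interior_mem by (auto simp: cone_pos_def_def)
qed

text \<open>
  If the value at \<open>u\<close> is not positive, then dividing by \<open>(norm u)\<^sup>2 / 2\<close>
  shows that \<open>quad_form M v + (2 / norm u) *\<^sub>R (L *v v)\<close> lies in \<open>- K\<close>,
  where \<open>v\<close> is the normalised \<open>u\<close>. On the unit sphere the quadratic form takes its
  values in a compact subset of \<open>interior K\<close>, which has a positive distance
  \<open>d\<close> from \<open>- K\<close>, while the linear part has size at most
  \<open>2 * C / norm u\<close>. Hence \<open>norm u\<close> is at most \<open>2 * C / d\<close>.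
\<close>

lemma model_coercive:
  fixes L :: "real ^ 'n ^ 'm"
  assumes "cone_pos_def K M"
  shows "\<exists>R. \<forall>u. R < norm u \<longrightarrow> 0 < gerstewitz K e (L *v u + (1/2) *\<^sub>R quad_form M u)"
proof -
  have "compact (quad_form M ` sphere 0 1)"
    by (intro compact_continuous_image continuous_on_quad_form) auto
  moreover have "closed (uminus ` K)"
    using closed_K by (rule closed_negations)
  moreover have "quad_form M ` sphere 0 1 \<inter> uminus ` K = {}"
  proof -
    have False if "norm v = 1" "quad_form M v \<in> uminus ` K" for v
    proof -
      have int: "quad_form M v \<in> interior K"
        using assms that(1) unfolding cone_pos_def_def by (metis norm_zero zero_neq_one)
      then have "quad_form M v = 0"
        using that(2) by (auto intro: antisym_mem interior_mem)
      then show False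
        using int zero_notin_interior by simp
    qed
    then show ?thesis
      unfolding disjoint_iff by (metis imageE mem_sphere_0)
  qed
  ultimately obtain d where d: "d > 0"
    "\<And>v z. norm v = 1 \<Longrightarrow> - z \<in> K \<Longrightarrow> d \<le> dist (quad_form M v) z"
    by (rule separate_compact_closed[elim_format]) (force simp: image_iff)
  obtain C where C: "C > 0" "\<And>u. norm (L *v u) \<le> C * norm u"
    using bounded_linear.pos_bounded[OF matrix_vector_mul_bounded_linear[of L]]
    by (metis mult.commute)
  have "0 < gerstewitz K e (L *v u + (1/2) *\<^sub>R quad_form M u)" if u: "2 * C / d < norm u" for u
  proof (rule ccontr)
    assume "\<not> ?thesis"
    then have mem: "- (L *v u + (1/2) *\<^sub>R quad_form M u) \<in> K"
      using gerstewitz_le_iff[of _ 0] by (simp add: not_less)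
    have "0 < norm u"
      using u C(1) d(1) by (smt (verit) divide_pos_pos)
    define v where "v = (1 / norm u) *\<^sub>R u"
    have v: "norm v = 1" "u = norm u *\<^sub>R v"
      using \<open>0 < norm u\<close> by (auto simp: v_def)
    define z where "z = (2 / norm u) *\<^sub>R (L *v v) + quad_form M v"
    have "quad_form M u = (norm u)\<^sup>2 *\<^sub>R quad_form M v" "L *v u = norm u *\<^sub>R (L *v v)"
      using v(2) quad_form_scaleR[of M "norm u" v] matrix_vector_mult_scaleR[of L "norm u" v]
      by auto
    then have "- z = (2 / (norm u)\<^sup>2) *\<^sub>R (- (L *v u + (1/2) *\<^sub>R quad_form M u))"
      using \<open>0 < norm u\<close> by (simp add: z_def algebra_simps power2_eq_square)
    then have "- z \<in> K"
      using scale_mem[OF mem] by simp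
    then have "d \<le> dist (quad_form M v) z"
      using d(2) v(1) by blast
    also have "\<dots> = (2 / norm u) * norm (L *v v)"
      by (simp add: z_def dist_norm)
    also have "\<dots> \<le> (2 / norm u) * C"
      using C(2)[of v] v(1) by (intro mult_left_mono) auto
    finally show False
      using u \<open>0 < norm u\<close> d(1) by (simp add: field_simps)
  qed
  then show ?thesis
    by blast
qed

lemma xi_less_iff:
  assumes "num_min K p f x \<ge> 1"
  shows "xi K e p f B x a u < c \<longleftrightarrow>
    (\<forall>j\<in>{1..num_min K p f x}. gerstewitz K e (transpose (grad (f (a j)) x) *v u
                 + (1/2) *\<^sub>R quad_form (B (a j) x) u) < c)"
  using assms unfolding xi_def by (subst Max_less_iff) auto

text \<open>
  A maximum is at least its first term, so it inherits coercivity from that term. The value at 0 is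
  at most 0, hence a minimiser over a large enough ball is a global one.
\<close>

lemma xi_attains_min:
  assumes w: "num_min K p f x \<ge> 1"
    and pd: "\<And>j. j \<in> {1..num_min K p f x} \<Longrightarrow> cone_pos_def K (B (a j) x)"
  obtains u0 where "\<And>u. xi K e p f B x a u0 \<le> xi K e p f B x a u"
proof -
  define g where "g = (\<lambda>j u. gerstewitz K e (transpose (grad (f (a j)) x) *v u
                 + (1/2) *\<^sub>R quad_form (B (a j) x) u))"
  have xi: "xi K e p f B x a u = Max ((\<lambda>j. g j u) ` {1..num_min K p f x})" for u
    by (simp add: xi_def g_def)
  have cont_g: "continuous_on UNIV (g j)" for j
    unfolding g_def
    by (intro continuous_on_compose2[OF continuous_on_gerstewitz] continuous_intros
        matrix_vector_mult_linear_continuous_on continuous_on_quad_form) auto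
  have cont: "continuous_on UNIV (xi K e p f B x a)"
    unfolding xi using w cont_g by (intro continuous_on_Max) auto
  have "cone_pos_def K (B (a 1) x)"
    using pd w by simp
  then obtain R where "\<And>u. R < norm u \<Longrightarrow> 0 < g 1 u"
    unfolding g_def using model_coercive by metis
  moreover have "g 1 u \<le> xi K e p f B x a u" for u
    unfolding xi using w by (intro Max_ge) auto
  ultimately have pos: "0 < xi K e p f B x a u" if "R < norm u" for u
    using that by (meson less_le_trans)
  have "g j 0 \<le> 0" for j
    by (simp add: g_def gerstewitz_le_iff quad_form_0 zero_mem)
  then have xi0: "xi K e p f B x a 0 \<le> 0"
    unfolding xi using w by simp
  obtain u0 where u0: "u0 \<in> cball 0 (max R 0)"
    "\<And>u. u \<in> cball 0 (max R 0) \<Longrightarrow> xi K e p f B x a u0 \<le> xi K e p f B x a u"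
    using continuous_attains_inf[of "cball 0 (max R 0)" "xi K e p f B x a"]
      continuous_on_subset[OF cont] by auto
  have "xi K e p f B x a u0 \<le> xi K e p f B x a u" for u
  proof (cases "norm u \<le> max R 0")
    case True
    then show ?thesis using u0(2) by simp
  next
    case False
    then have "0 < xi K e p f B x a u"
      using pos by simp
    then show ?thesis
      using u0(2)[of 0] xi0 by simp
  qed
  then show ?thesis
    by (rule that)
qed

lemma partition_setD:
  assumes "a \<in> partition_set K p f r x" "j \<in> {1..num_min K p f x}"
  shows "a j \<in> {1..p}" "f (a j) x = r x j"
  using assms by (auto simp: partition_set_def active_indices_at_def active_indices_def PiE_iff)

lemma finite_partition_set: "finite (partition_set K p f r x)"
  unfolding partition_set_def
  by (intro finite_PiE) (auto simp: active_indices_at_def active_indices_def)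

text \<open>
  Minimal elements exist, so the maximum in \<open>xi\<close> ranges over a nonempty set.
\<close>

lemma num_min_pos:
  assumes "p \<ge> 1"
  shows "num_min K p f x \<ge> 1"
proof -
  have fin: "finite (set_map p f x)"
    by (simp add: set_map_def)
  have "f 1 x \<in> set_map p f x"
    using assms by (auto simp: set_map_def)
  then have "min_elements (set_map p f x) K \<noteq> {}"
    using min_element_below[OF fin] by blast
  moreover have "finite (min_elements (set_map p f x) K)"
    using fin by (simp add: min_elements_def)
  ultimately show ?thesis
    by (simp add: num_min_def Suc_le_eq card_gt_0_iff)
qed

text \<open>
  Minimising first over \<open>u\<close> for each \<open>a\<close>, then over the finite partition set,
  gives a pair at which the model is least, so \<open>LEAST\<close> denotes a true minimum.
\<close>

lemma Phi_le_xi: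
  assumes p: "p \<ge> 1"
    and pd: "\<And>i. i \<in> {1..p} \<Longrightarrow> cone_pos_def K (B i x)"
    and a: "a \<in> partition_set K p f r x"
  shows "Phi K e p f B r x \<le> xi K e p f B x a u"
proof -
  let ?P = "partition_set K p f r x"
  let ?xi = "xi K e p f B x"
  have "\<exists>u0. \<forall>u. ?xi a u0 \<le> ?xi a u" if "a \<in> ?P" for a
    using xi_attains_min[OF num_min_pos[OF p], where a=a and B=B] pd partition_setD[OF that] by metis
  then obtain U where U: "\<And>a u. a \<in> ?P \<Longrightarrow> ?xi a (U a) \<le> ?xi a u"
    by metis
  have P: "finite ?P" "?P \<noteq> {}"
    using a finite_partition_set by auto
  obtain a0 where a0: "a0 \<in> ?P" "\<And>a. a \<in> ?P \<Longrightarrow> ?xi a0 (U a0) \<le> ?xi a (U a)"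
    using ex_min_if_finite[of "(\<lambda>a. ?xi a (U a)) ` ?P"] P by (auto simp: not_less)
  have min: "?xi a0 (U a0) \<le> ?xi a u" if "a \<in> ?P" for a u
    using a0(2)[OF that] U[OF that, of u] by linarith
  have "Phi K e p f B r x = ?xi a0 (U a0)"
    unfolding Phi_def using a0(1) min by (intro Least_equality) auto
  then show ?thesis
    using min[OF a] by simp
qed

text \<open>
  With first-order term \<open>l\<close> and quadratic term \<open>q\<close> at \<open>u\<close>, the model term at
  \<open>s *\<^sub>R u\<close> is \<open>s *\<^sub>R (l + (s / 2) *\<^sub>R q)\<close>. The inner sum tends to
  \<open>l\<close>, so for small \<open>s > 0\<close> it lies in the open cone \<open>- interior K\<close>, and
  so does its positive multiple.
\<close>

lemma nonstationary_xi_neg: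
  assumes p: "p \<ge> 1" and ns: "\<not> stationary K p f r x"
  obtains a u where "a \<in> partition_set K p f r x" "xi K e p f B x a u < 0"
proof -
  obtain a u where a: "a \<in> partition_set K p f r x"
    and u: "\<And>j. j \<in> {1..num_min K p f x} \<Longrightarrow>
        transpose (grad (f (a j)) x) *v u \<in> uminus ` interior K"
    using ns unfolding stationary_def by blast
  let ?L = "\<lambda>j. transpose (grad (f (a j)) x)"
  let ?q = "\<lambda>j. quad_form (B (a j) x)"
  have "\<forall>\<^sub>F s in at_right 0. - (?L j *v u + (s / 2) *\<^sub>R ?q j u) \<in> interior K"
    if "j \<in> {1..num_min K p f x}" for j
  proof (rule topological_tendstoD)
    show "((\<lambda>s. - (?L j *v u + (s / 2) *\<^sub>R ?q j u)) \<longlongrightarrow> - (?L j *v u + (0 / 2) *\<^sub>R ?q j u)) (at_right 0)"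
      by (intro tendsto_intros) auto
  qed (use u[OF that] in auto)
  then have "\<forall>\<^sub>F s in at_right 0. \<forall>j\<in>{1..num_min K p f x}.
      - (?L j *v u + (s / 2) *\<^sub>R ?q j u) \<in> interior K"
    by (intro eventually_ball_finite) auto
  then have "\<forall>\<^sub>F s in at_right 0. 0 < s \<and> (\<forall>j\<in>{1..num_min K p f x}.
      - (?L j *v u + (s / 2) *\<^sub>R ?q j u) \<in> interior K)"
    by (intro eventually_conj eventually_at_right_less)
  then obtain s :: real where s: "0 < s" "\<And>j. j \<in> {1..num_min K p f x} \<Longrightarrow>
      - (?L j *v u + (s / 2) *\<^sub>R ?q j u) \<in> interior K"
    using eventually_happens'[OF trivial_limit_at_right_real] by blast
  have "- (?L j *v (s *\<^sub>R u) + (1/2) *\<^sub>R ?q j (s *\<^sub>R u)) \<in> interior K"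
    if "j \<in> {1..num_min K p f x}" for j
    using interior_scale_mem[OF s(2)[OF that] s(1)]
    by (simp add: quad_form_scaleR matrix_vector_mult_scaleR power2_eq_square algebra_simps)
  then have "xi K e p f B x a (s *\<^sub>R u) < 0"
    by (simp add: xi_less_iff[OF num_min_pos[OF p]] gerstewitz_less_0_iff)
  with a show ?thesis
    by (rule that)
qed

section \<open>Sufficient decrease\<close>

text \<open>
  Divided by \<open>t\<close>, the required difference tends to
  \<open>\<beta> *\<^sub>R g' u - g' u = (1 - \<beta>) *\<^sub>R (- g' u)\<close>, a point of the
  open set \<open>interior K\<close>, and hence is eventually in it.
\<close>

lemma armijo_descent:
  fixes g :: "real ^ 'n \<Rightarrow> real ^ 'm"
  assumes g: "(g has_derivative g') (at x)"
    and u: "- g' u \<in> interior K" and "\<beta> < 1"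
  shows "\<forall>\<^sub>F t in at_right 0. cone_le K (g (x + t *\<^sub>R u)) (g x + (\<beta> * t) *\<^sub>R g' u)"
proof -
  have "((\<lambda>t. x + t *\<^sub>R u) has_derivative (\<lambda>t. t *\<^sub>R u)) (at_right 0)"
    by (auto intro!: derivative_eq_intros)
  moreover have "(g has_derivative g') (at (x + 0 *\<^sub>R u))"
    using g by simp
  ultimately have "((\<lambda>t. g (x + t *\<^sub>R u)) has_derivative (\<lambda>t. g' (t *\<^sub>R u))) (at_right 0)"
    by (rule has_derivative_compose)
  then have "((\<lambda>t. g (x + t *\<^sub>R u)) has_vector_derivative g' u) (at_right 0)"
    using linear_scale[OF has_derivative_linear[OF g]] by (simp add: has_vector_derivative_def)
  then have "((\<lambda>t. (1 / \<bar>t\<bar>) *\<^sub>R (g (x + t *\<^sub>R u) - (g x + t *\<^sub>R g' u)) + g' u) \<longlongrightarrow> 0 + g' u)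
      (at_right 0)"
    unfolding has_vector_derivative_def has_derivative_within
    by (intro tendsto_add tendsto_const) auto
  moreover have "\<forall>\<^sub>F t in at_right 0. (1 / \<bar>t\<bar>) *\<^sub>R (g (x + t *\<^sub>R u) - (g x + t *\<^sub>R g' u)) + g' u
      = (1 / t) *\<^sub>R (g (x + t *\<^sub>R u) - g x)"
    using eventually_at_right_less[of 0]
    by eventually_elim (simp add: algebra_simps)
  ultimately have "((\<lambda>t. (1 / t) *\<^sub>R (g (x + t *\<^sub>R u) - g x)) \<longlongrightarrow> g' u) (at_right 0)"
    using Lim_transform_eventually by fastforce
  then have "((\<lambda>t. \<beta> *\<^sub>R g' u - (1 / t) *\<^sub>R (g (x + t *\<^sub>R u) - g x)) \<longlongrightarrow> \<beta> *\<^sub>R g' u - g' u) (at_right 0)"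
    by (intro tendsto_intros)
  moreover have "\<beta> *\<^sub>R g' u - g' u \<in> interior K"
    using interior_scale_mem[OF u, of "1 - \<beta>"] \<open>\<beta> < 1\<close> by (simp add: algebra_simps)
  ultimately have "\<forall>\<^sub>F t in at_right 0.
      \<beta> *\<^sub>R g' u - (1 / t) *\<^sub>R (g (x + t *\<^sub>R u) - g x) \<in> interior K"
    by (intro topological_tendstoD) auto
  then show ?thesis
    using eventually_at_right_less[of 0]
  proof eventually_elim
    case (elim t)
    then have "t *\<^sub>R (\<beta> *\<^sub>R g' u - (1 / t) *\<^sub>R (g (x + t *\<^sub>R u) - g x)) \<in> K"
      by (intro scale_mem interior_mem) auto
    then show ?case
      using elim(2) by (simp add: cone_le_def algebra_simps)
  qed
qed

end

lemma has_derivative_grad: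
  assumes "twice_continuously_differentiable g"
  shows "(g has_derivative (\<lambda>h. transpose (grad g x) *v h)) (at x)"
proof -
  have "g differentiable (at x)"
    using assms by (auto simp: twice_continuously_differentiable_def differentiable_def)
  then show ?thesis
    by (simp add: grad_def transpose_transpose flip: jacobian_works)
qed

theorem proposition4p5:
  fixes K :: "(real ^ 'm) set"
    and e :: "real ^ 'm"
    and p :: nat
    and f :: "nat \<Rightarrow> real ^ 'n \<Rightarrow> real ^ 'm"
    and B :: "nat \<Rightarrow> real ^ 'n \<Rightarrow> 'm \<Rightarrow> real ^ 'n ^ 'n"
    and r :: "real ^ 'n \<Rightarrow> nat \<Rightarrow> real ^ 'm"
    and \<beta> :: real
    and xb ub :: "real ^ 'n"
    and ab :: "nat \<Rightarrow> nat"
  assumes "closed K" and "convex K" and "pointed_cone K" and "interior K \<noteq> {}"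
    and "e \<in> interior K"
    and "p \<ge> 1"
    and "\<And>i. i \<in> {1..p} \<Longrightarrow> twice_continuously_differentiable (f i)"
    and "\<And>i x l. i \<in> {1..p} \<Longrightarrow> transpose (B i x l) = B i x l"
    and "\<And>i x. i \<in> {1..p} \<Longrightarrow> cone_pos_def K (B i x)"
    and "min_enumeration K p f r"
    and "0 < \<beta>" and "\<beta> < 1"
    and "\<not> stationary K p f r xb"
    and "ab \<in> partition_set K p f r xb"
    and "Phi K e p f B r xb = xi K e p f B xb ab ub"
  shows "\<exists>tt>0.
    (\<forall>t \<in> {0<..tt}. \<forall>j \<in> {1..num_min K p f xb}.
        cone_le K (f (ab j) (xb + t *\<^sub>R ub))
                  (f (ab j) xb + (\<beta> * t) *\<^sub>R (transpose (grad (f (ab j)) xb) *v ub))) \<and>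
    (\<forall>t \<in> {0<..tt}.
        lower_set_le K (set_map p f (xb + t *\<^sub>R ub))
          ((\<lambda>j. f (ab j) xb + (\<beta> * t) *\<^sub>R (transpose (grad (f (ab j)) xb) *v ub))
             ` {1..num_min K p f xb}) \<and>
        lower_set_less K
          ((\<lambda>j. f (ab j) xb + (\<beta> * t) *\<^sub>R (transpose (grad (f (ab j)) xb) *v ub))
             ` {1..num_min K p f xb})
          (set_map p f xb))"
proof -
  interpret solid_pointed_cone K e
    using assms by unfold_locales
  let ?J = "{1..num_min K p f xb}"
  let ?d = "\<lambda>j. transpose (grad (f (ab j)) xb) *v ub"
  let ?y = "\<lambda>t j. f (ab j) xb + (\<beta> * t) *\<^sub>R ?d j"
  note ab = partition_setD[OF \<open>ab \<in> partition_set K p f r xb\<close>]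

  obtain a u where a: "a \<in> partition_set K p f r xb" and "xi K e p f B xb a u < 0"
    using nonstationary_xi_neg[OF \<open>p \<ge> 1\<close> \<open>\<not> stationary K p f r xb\<close>] .
  then have "xi K e p f B xb ab ub < 0"
    using Phi_le_xi[where u=u and B=B, OF \<open>p \<ge> 1\<close> assms(9) a] assms(15) by simp
  then have model: "- (?d j + (1/2) *\<^sub>R quad_form (B (ab j) xb) ub) \<in> interior K" if "j \<in> ?J" for j
    using that by (simp add: xi_less_iff[OF num_min_pos[OF \<open>p \<ge> 1\<close>]] gerstewitz_less_0_iff)
  have d: "- ?d j \<in> interior K" if j: "j \<in> ?J" for j
  proof -
    have "(1/2) *\<^sub>R quad_form (B (ab j) xb) ub \<in> K"
      using assms(9) ab(1)[OF j] by (intro scale_mem quad_form_mem) auto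
    then show ?thesis
      using interior_add_mem[OF model[OF j]] by fastforce
  qed

  have "\<forall>\<^sub>F t in at_right 0. \<forall>j\<in>?J. cone_le K (f (ab j) (xb + t *\<^sub>R ub)) (?y t j)"
    using armijo_descent[OF has_derivative_grad d \<open>\<beta> < 1\<close>] ab(1) assms(7)
    by (intro eventually_ball_finite) auto
  \<comment> \<open>Halving \<open>b\<close> turns the open range of step sizes into a half-closed one.\<close>
  then obtain b where b: "b > 0"
    "\<And>t j. 0 < t \<Longrightarrow> t < b \<Longrightarrow> j \<in> ?J \<Longrightarrow> cone_le K (f (ab j) (xb + t *\<^sub>R ub)) (?y t j)"
    unfolding eventually_at_right_field by auto
  then have descent: "cone_le K (f (ab j) (xb + t *\<^sub>R ub)) (?y t j)"
    if "t \<in> {0<..b / 2}" "j \<in> ?J" for t j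
    using that by auto

  have le: "lower_set_le K (set_map p f (xb + t *\<^sub>R ub)) (?y t ` ?J)" if t: "t \<in> {0<..b / 2}" for t
    unfolding lower_set_le_def
  proof (rule image_subsetI)
    fix j assume j: "j \<in> ?J"
    have "f (ab j) (xb + t *\<^sub>R ub) \<in> set_map p f (xb + t *\<^sub>R ub)"
      using ab(1)[OF j] by (auto simp: set_map_def)
    from set_plus_intro[OF this descent[OF t j, unfolded cone_le_def]]
    show "?y t j \<in> set_map p f (xb + t *\<^sub>R ub) + K"
      by simp
  qed

  have less: "lower_set_less K (?y t ` ?J) (set_map p f xb)" if t: "t \<in> {0<..b / 2}" for t
    unfolding lower_set_less_def
  proof
    fix z assume z: "z \<in> set_map p f xb"
    obtain m where m: "m \<in> min_elements (set_map p f xb) K" "z - m \<in> K"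
      using min_element_below[OF _ z] by (auto simp: set_map_def)
    then obtain j where j: "j \<in> ?J" "m = r xb j"
      using assms(10) unfolding min_enumeration_def bij_betw_def by blast
    \<comment> \<open>This sum is the difference between \<open>z\<close> and \<open>?y t j\<close>.\<close>
    have "(\<beta> * t) *\<^sub>R (- ?d j) + (z - m) \<in> interior K"
      using t \<open>0 < \<beta>\<close> d[OF j(1)] m(2) by (intro interior_add_mem interior_scale_mem) auto
    from set_plus_intro[OF imageI[OF j(1)] this, of "?y t"]
    show "z \<in> ?y t ` ?J + interior K"
      using ab(2)[OF j(1)] j(2) by simp
  qed

  show ?thesis
    using b(1) descent le less by (intro exI[of _ "b / 2"]) auto
qed

end
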